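(* Let $\alpha:I\to E^3$ be a Frenet curve in $E^3$ and let $\beta$ be a Mannheim-direction curve of $\alpha$. The following statements are equivalent: (i) $\alpha$ is a helix. (ii) $\alpha$ is a Mannheim-donor curve of a slant helix. (iii) A Mannheim-direction curve of $\alpha$ is a slant helix.
   Context: $I\subset\mathbb{R}$ is an open interval and curves are smooth. A unit speed curve $\alpha:I\to E^3$ is a Frenet curve if its curvature $\kappa=\|\alpha''\|$ is nowhere zero; then $T=\alpha'$, $N=\alpha''/\kappa$, $B=T\times N$, and $T'=\kappa N$, $N'=-\kappa T+\tau B$, $B'=-\tau N$, where $\tau$ is the torsion. For a unit vector field $X(s)=a(s)T(s)+b(s)N(s)+c(s)B(s)$ with $a,b,c$ smooth and $a^2+b^2+c^2=1$, an $X$-direction curve of $\alpha$ is a curve $\beta:I\to E^3$ with $\beta'(s)=X(s)$; the parameter $s$ is then also arc length for $\beta$, whose Frenet apparatus is $\{\overline T,\overline N,\overline B\},\overline\kappa,\overline\tau$. An $X$-direction curve $\beta$ of $\alpha$ (for some such $X$) is called a Mannheim-direction curve of $\alpha$ if $\beta$ is a Mannheim curve of $\alpha$ (and $\alpha$ a Mannheim partner curve of $\beta$), in the sense that $\beta$ is a Frenet curve with $\overline N=B$ at each common parameter value $s$; then $\alpha$ is called a Mannheim-donor curve of $\beta$. A Frenet curve is a (general) helix if $\tau/\kappa$ is constant. A Frenet curve is a slant helix if its principal normal vectors make a constant angle with a fixed direction; equivalently, $\frac{\kappa^2}{(\kappa^2+\tau^2)^{3/2}}\left(\frac{\tau}{\kappa}\right)'$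 is constant. *)

theory Defs
  imports "HOL-Analysis.Analysis"
begin

text \<open>
  Curves are total functions of type \<open>real \<Rightarrow> real^3\<close>; only their values on the open
  interval \<open>I\<close> matter, and derivatives at points of \<open>I\<close> depend on no others.
\<close>

definition open_interval :: "real set \<Rightarrow> bool" where
  "open_interval I \<longleftrightarrow> open I \<and> is_interval I \<and> I \<noteq> {}"

definition vderiv :: "(real \<Rightarrow> 'a::real_normed_vector) \<Rightarrow> real \<Rightarrow> 'a" where
  "vderiv f s = vector_derivative f (at s)"

definition smooth_on :: "real set \<Rightarrow> (real \<Rightarrow> 'a::real_normed_vector) \<Rightarrow> bool" where
  "smooth_on I f \<longleftrightarrow> (\<forall>n. \<forall>s\<in>I. ((vderiv ^^ n) f) differentiable (at s))"

definition tangent :: "(real \<Rightarrow> real^3) \<Rightarrow> real \<Rightarrow> real^3" where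
  "tangent \<alpha> = vderiv \<alpha>"

definition curvature :: "(real \<Rightarrow> real^3) \<Rightarrow> real \<Rightarrow> real" where
  "curvature \<alpha> s = norm (vderiv (vderiv \<alpha>) s)"

definition normal :: "(real \<Rightarrow> real^3) \<Rightarrow> real \<Rightarrow> real^3" where
  "normal \<alpha> s = vderiv (vderiv \<alpha>) s /\<^sub>R curvature \<alpha> s"

definition binormal :: "(real \<Rightarrow> real^3) \<Rightarrow> real \<Rightarrow> real^3" where
  "binormal \<alpha> s = cross3 (tangent \<alpha> s) (normal \<alpha> s)"

text \<open>The sign convention of the torsion is that of the Frenet equation \<open>B' = -\<tau> N\<close>.\<close>

definition torsion :: "(real \<Rightarrow> real^3) \<Rightarrow> real \<Rightarrow> real" where
  "torsion \<alpha> s = - (vderiv (binormal \<alpha>) s \<bullet> normal \<alpha> s)"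

definition frenet_curve :: "real set \<Rightarrow> (real \<Rightarrow> real^3) \<Rightarrow> bool" where
  "frenet_curve I \<alpha> \<longleftrightarrow>
     smooth_on I \<alpha> \<and> (\<forall>s\<in>I. norm (vderiv \<alpha> s) = 1) \<and> (\<forall>s\<in>I. curvature \<alpha> s \<noteq> 0)"

definition unit_frame_field ::
    "real set \<Rightarrow> (real \<Rightarrow> real^3) \<Rightarrow> (real \<Rightarrow> real^3) \<Rightarrow> bool" where
  "unit_frame_field I \<alpha> X \<longleftrightarrow>
     (\<exists>a b c :: real \<Rightarrow> real.
        smooth_on I a \<and> smooth_on I b \<and> smooth_on I c \<and>
        (\<forall>s\<in>I. (a s)\<^sup>2 + (b s)\<^sup>2 + (c s)\<^sup>2 = 1 \<and>
               X s = a s *\<^sub>R tangent \<alpha> s + b s *\<^sub>R normal \<alpha> s + c s *\<^sub>R binormal \<alpha> s))"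

definition direction_curve ::
    "real set \<Rightarrow> (real \<Rightarrow> real^3) \<Rightarrow> (real \<Rightarrow> real^3) \<Rightarrow> (real \<Rightarrow> real^3) \<Rightarrow> bool" where
  "direction_curve I X \<alpha> \<beta> \<longleftrightarrow>
     frenet_curve I \<alpha> \<and> unit_frame_field I \<alpha> X \<and>
     smooth_on I \<beta> \<and> (\<forall>s\<in>I. (\<beta> has_vector_derivative X s) (at s))"

text \<open>
  \<open>mannheim_curve I \<alpha> \<beta>\<close>: \<open>\<beta>\<close> is a Mannheim curve of \<open>\<alpha>\<close>, and \<open>\<alpha>\<close> a Mannheim partner
  curve of \<open>\<beta>\<close>. The arguments of \<open>mannheim_direction_curve\<close> are in the same order.
\<close>

definition mannheim_curve :: "real set \<Rightarrow> (real \<Rightarrow> real^3) \<Rightarrow> (real \<Rightarrow> real^3) \<Rightarrow> bool" where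
  "mannheim_curve I \<alpha> \<beta> \<longleftrightarrow>
     frenet_curve I \<beta> \<and> (\<forall>s\<in>I. normal \<beta> s = binormal \<alpha> s)"

definition mannheim_direction_curve ::
    "real set \<Rightarrow> (real \<Rightarrow> real^3) \<Rightarrow> (real \<Rightarrow> real^3) \<Rightarrow> bool" where
  "mannheim_direction_curve I \<alpha> \<beta> \<longleftrightarrow>
     (\<exists>X. direction_curve I X \<alpha> \<beta>) \<and> mannheim_curve I \<alpha> \<beta>"

text \<open>\<open>mannheim_donor_curve I \<beta> \<alpha>\<close>: \<open>\<alpha>\<close> is a Mannheim-donor curve of \<open>\<beta>\<close>.\<close>

definition mannheim_donor_curve ::
    "real set \<Rightarrow> (real \<Rightarrow> real^3) \<Rightarrow> (real \<Rightarrow> real^3) \<Rightarrow> bool" where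
  "mannheim_donor_curve I \<beta> \<alpha> \<longleftrightarrow> mannheim_direction_curve I \<alpha> \<beta>"

definition helix :: "real set \<Rightarrow> (real \<Rightarrow> real^3) \<Rightarrow> bool" where
  "helix I \<alpha> \<longleftrightarrow>
     frenet_curve I \<alpha> \<and> (\<exists>c. \<forall>s\<in>I. torsion \<alpha> s / curvature \<alpha> s = c)"

definition vector_angle :: "real^3 \<Rightarrow> real^3 \<Rightarrow> real" where
  "vector_angle u v = arccos (u \<bullet> v / (norm u * norm v))"

definition slant_helix :: "real set \<Rightarrow> (real \<Rightarrow> real^3) \<Rightarrow> bool" where
  "slant_helix I \<alpha> \<longleftrightarrow>
     frenet_curve I \<alpha> \<and>
     (\<exists>d \<theta>. d \<noteq> 0 \<and> (\<forall>s\<in>I. vector_angle (normal \<alpha> s) d = \<theta>))"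

end

theory Submission
  imports Defs
begin

text \<open>
  A Mannheim-direction curve of \<open>\<alpha>\<close> is a Frenet curve whose principal normal is the binormal \<open>B\<close>
  of \<open>\<alpha>\<close>. So each such curve is a slant helix exactly when \<open>B\<close> makes a constant angle with a
  fixed direction, a condition in which the direction curve itself no longer occurs. All three
  statements thus become equivalent once it is shown that \<open>B\<close> makes a constant angle with a fixed
  direction if and only if \<open>\<tau> / \<kappa>\<close> is constant.

  If \<open>\<tau> = c \<kappa>\<close>, then \<open>d = c T + B\<close> is a constant vector, since \<open>d' = (c \<kappa> - \<tau>) N = 0\<close>, and
  \<open>B \<bullet> d = 1\<close> (\<open>helix_imp_binormal_angle\<close>).

  Conversely, let \<open>B \<bullet> d\<close> be constant. Differentiation gives \<open>\<tau> (N \<bullet> d) = 0\<close>. This is where the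
  Mannheim-direction curve is needed: its existence forces \<open>\<tau>\<close> to have no zero
  (\<open>torsion_nonzero_if_binormal_is_normal\<close>). On a planar arc the binormal is constant, so there
  a constant \<open>B \<bullet> d\<close> would say nothing about \<open>N \<bullet> d\<close>. Therefore \<open>N \<bullet> d = 0\<close>, so that \<open>T \<bullet> d\<close> is constant
  too, and differentiating \<open>N \<bullet> d = 0\<close> gives \<open>\<tau> (B \<bullet> d) = \<kappa> (T \<bullet> d)\<close>, where
  \<open>T \<bullet> d\<close> and \<open>B \<bullet> d \<noteq> 0\<close> are constant (\<open>binormal_angle_imp_helix\<close>).
\<close>

section \<open>Derivatives along a curve\<close>

lemma has_vector_derivative_inner:
  fixes f g :: "real \<Rightarrow> 'a::real_inner"
  assumes "(f has_vector_derivative f') (at s)" "(g has_vector_derivative g') (at s)"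
  shows "((\<lambda>t. f t \<bullet> g t) has_vector_derivative f s \<bullet> g' + f' \<bullet> g s) (at s)"
  by (rule bounded_bilinear.has_vector_derivative[OF bounded_bilinear_inner assms])

lemma has_vector_derivative_cross3:
  assumes "(f has_vector_derivative f') (at s)" "(g has_vector_derivative g') (at s)"
  shows "((\<lambda>t. cross3 (f t) (g t)) has_vector_derivative
           cross3 (f s) g' + cross3 f' (g s)) (at s)"
  using bilinear_cross
  by (intro bounded_bilinear.has_vector_derivative assms)
     (simp add: bilinear_conv_bounded_bilinear)

lemma vderiv_unique:
  "(f has_vector_derivative f') (at s) \<Longrightarrow> vderiv f s = f'"
  by (simp add: vderiv_def vector_derivative_at)

lemma zero_derivative_imp_constant:
  fixes f :: "real \<Rightarrow> 'a::real_normed_vector"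
  assumes I: "open_interval I"
    and f: "\<And>s. s \<in> I \<Longrightarrow> (f has_vector_derivative 0) (at s)"
  obtains c where "\<And>s. s \<in> I \<Longrightarrow> f s = c"
proof -
  have "convex I"
    using I by (simp add: open_interval_def is_interval_convex_1)
  then show ?thesis
    using has_vector_derivative_zero_constant[of I f] f that
    by (metis has_vector_derivative_at_within)
qed

text \<open>
  Taking the derivative \<open>f'\<close> as given, the lemma differentiates an identity \<open>f = c\<close> that holds on
  \<open>I\<close>: with \<open>f\<close> an inner product of two curves, the product rule supplies \<open>f'\<close>, and the conclusion
  is a linear relation between inner products.
\<close>

lemma constant_imp_derivative_eq_zero:
  assumes I: "open_interval I" and s: "s \<in> I"
    and f: "(f has_vector_derivative f') (at s)"
    and c: "\<And>t. t \<in> I \<Longrightarrow> f t = c"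
  shows "f' = 0"
proof -
  have "((\<lambda>t. c) has_vector_derivative f') (at s)"
    using I s c
    by (intro has_vector_derivative_transform_within_open[OF f]) (auto simp: open_interval_def)
  then show ?thesis
    using vector_derivative_unique_at has_vector_derivative_const by blast
qed

section \<open>Frenet frame and Frenet equations\<close>

lemma orthonormal_frame_expansion:
  fixes u v x :: "real^3"
  assumes u: "norm u = 1" and v: "norm v = 1" and uv: "u \<bullet> v = 0"
  defines "w \<equiv> cross3 u v"
  shows "x = (x \<bullet> u) *\<^sub>R u + (x \<bullet> v) *\<^sub>R v + (x \<bullet> w) *\<^sub>R w"
proof -
  have uu: "u \<bullet> u = 1" and vv: "v \<bullet> v = 1"
    using u v by (simp_all add: norm_eq_1)
  have ww: "w \<bullet> w = 1" and wu: "w \<bullet> u = 0" and wv: "w \<bullet> v = 0"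
    using uu vv uv by (simp_all add: w_def dot_cross inner_commute dot_cross_self)
  define y where "y = x - ((x \<bullet> u) *\<^sub>R u + (x \<bullet> v) *\<^sub>R v + (x \<bullet> w) *\<^sub>R w)"
  have yu: "y \<bullet> u = 0" and yv: "y \<bullet> v = 0" and yw: "y \<bullet> w = 0"
    by (simp_all add: y_def inner_diff_left inner_add_left uu vv ww wu wv uv
          inner_commute[of v u] inner_commute[of u w] inner_commute[of v w])
  have "cross3 y w = 0"
    by (simp add: w_def Lagrange yu yv)
  moreover have "w \<noteq> 0"
    using ww by auto
  ultimately have "y = 0"
    using yw norm_and_cross_eq_0 by blast
  then show ?thesis
    by (simp add: y_def)
qed

context
  fixes I :: "real set" and \<alpha> :: "real \<Rightarrow> real^3"
  assumes I: "open_interval I" and \<alpha>: "frenet_curve I \<alpha>"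
begin

lemma curvature_pos:
  "s \<in> I \<Longrightarrow> curvature \<alpha> s > 0"
  using \<alpha> by (auto simp: frenet_curve_def curvature_def)

lemma norm_tangent:
  "s \<in> I \<Longrightarrow> norm (tangent \<alpha> s) = 1"
  using \<alpha> by (auto simp: frenet_curve_def tangent_def)

lemma norm_normal:
  "s \<in> I \<Longrightarrow> norm (normal \<alpha> s) = 1"
  using curvature_pos[of s] by (simp add: normal_def curvature_def)

lemma second_derivative_eq:
  "s \<in> I \<Longrightarrow> vderiv (vderiv \<alpha>) s = curvature \<alpha> s *\<^sub>R normal \<alpha> s"
  using curvature_pos[of s] by (simp add: normal_def)

lemma iterated_vderiv_differentiable:
  "s \<in> I \<Longrightarrow> (vderiv ^^ n) \<alpha> differentiable (at s)"
  using \<alpha> by (auto simp: frenet_curve_def smooth_on_def)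

lemma has_vector_derivative_tangent:
  assumes "s \<in> I"
  shows "(tangent \<alpha> has_vector_derivative curvature \<alpha> s *\<^sub>R normal \<alpha> s) (at s)"
proof -
  have "vderiv \<alpha> differentiable (at s)"
    using iterated_vderiv_differentiable[OF assms, of 1] by simp
  then have "(vderiv \<alpha> has_vector_derivative vderiv (vderiv \<alpha>) s) (at s)"
    by (simp add: vderiv_def[of "vderiv \<alpha>"] vector_derivative_works)
  then show ?thesis
    using second_derivative_eq[OF assms] by (simp add: tangent_def)
qed

lemma tangent_inner_normal:
  assumes s: "s \<in> I"
  shows "tangent \<alpha> s \<bullet> normal \<alpha> s = 0"
proof -
  note T' = has_vector_derivative_tangent[OF s]
  have "tangent \<alpha> t \<bullet> tangent \<alpha> t = 1" if "t \<in> I" for t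
    using norm_tangent[OF that] by (simp add: norm_eq_1)
  from constant_imp_derivative_eq_zero[OF I s has_vector_derivative_inner[OF T' T'] this]
  show ?thesis
    using curvature_pos[OF s] by (simp add: inner_commute)
qed

lemma binormal_orthonormal:
  assumes "s \<in> I"
  shows "binormal \<alpha> s \<bullet> binormal \<alpha> s = 1"
    and "binormal \<alpha> s \<bullet> tangent \<alpha> s = 0" and "binormal \<alpha> s \<bullet> normal \<alpha> s = 0"
  using norm_tangent[OF assms] norm_normal[OF assms] tangent_inner_normal[OF assms]
  by (simp_all add: binormal_def dot_cross dot_cross_self inner_commute norm_eq_1)

lemma frenet_frame_expansion:
  assumes "s \<in> I"
  shows "x = (x \<bullet> tangent \<alpha> s) *\<^sub>R tangent \<alpha> s + (x \<bullet> normal \<alpha> s) *\<^sub>R normal \<alpha> s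
            + (x \<bullet> binormal \<alpha> s) *\<^sub>R binormal \<alpha> s"
  unfolding binormal_def
  by (rule orthonormal_frame_expansion[OF norm_tangent norm_normal tangent_inner_normal])
     (use assms in auto)

lemma normal_differentiable:
  assumes s: "s \<in> I"
  shows "normal \<alpha> differentiable (at s)"
proof -
  have A: "vderiv (vderiv \<alpha>) differentiable (at s)"
    using iterated_vderiv_differentiable[OF s, of 2] by (simp add: numeral_2_eq_2)
  have nz: "vderiv (vderiv \<alpha>) s \<noteq> 0"
    using curvature_pos[OF s] by (auto simp: curvature_def)
  have "(\<lambda>t. norm (vderiv (vderiv \<alpha>) t)) differentiable (at s)"
    using differentiable_chain_at[OF A differentiable_norm_at[OF nz]] by (simp add: o_def)
  then have "(\<lambda>t. inverse (norm (vderiv (vderiv \<alpha>) t))) differentiable (at s)"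
    using nz by (intro differentiable_inverse) auto
  from differentiable_scaleR[OF this A] show ?thesis
    unfolding normal_def curvature_def by (simp add: fun_eq_iff)
qed

text \<open>
  Since \<open>T' \<parallel> N\<close>, the product rule leaves \<open>B' = T \<times> N'\<close>, which is orthogonal to \<open>T\<close>; it is
  orthogonal to the unit vector \<open>B\<close> as well, so that only its component along \<open>N\<close> survives. That
  component is \<open>- \<tau>\<close> by definition of the torsion.
\<close>

lemma has_vector_derivative_binormal:
  assumes s: "s \<in> I"
  shows "(binormal \<alpha> has_vector_derivative - torsion \<alpha> s *\<^sub>R normal \<alpha> s) (at s)"
proof -
  obtain N' where N': "(normal \<alpha> has_vector_derivative N') (at s)"
    using normal_differentiable[OF s] vector_derivative_works by blast
  have B': "(binormal \<alpha> has_vector_derivative cross3 (tangent \<alpha> s) N') (at s)"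
    using has_vector_derivative_cross3[OF has_vector_derivative_tangent[OF s] N']
    unfolding binormal_def[abs_def] by (simp add: cross_mult_left)
  define D where "D = cross3 (tangent \<alpha> s) N'"
  have "D \<bullet> tangent \<alpha> s = 0"
    by (simp add: D_def dot_cross_self)
  moreover have "D \<bullet> binormal \<alpha> s = 0"
    using constant_imp_derivative_eq_zero[OF I s has_vector_derivative_inner[OF B' B']
        binormal_orthonormal(1)]
    by (simp add: inner_commute D_def)
  moreover have "D \<bullet> normal \<alpha> s = - torsion \<alpha> s"
    using vderiv_unique[OF B'] by (simp add: torsion_def D_def)
  ultimately have "D = - torsion \<alpha> s *\<^sub>R normal \<alpha> s"
    by (subst frenet_frame_expansion[OF s, of D]) simp
  then show ?thesis
    using B' by (simp add: D_def)
qed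

text \<open>
  The coefficients of \<open>N'\<close> in the frame come from the other two Frenet equations by
  differentiating \<open>N \<bullet> N = 1\<close>, \<open>N \<bullet> T = 0\<close> and \<open>N \<bullet> B = 0\<close>.
\<close>

lemma has_vector_derivative_normal:
  assumes s: "s \<in> I"
  shows "(normal \<alpha> has_vector_derivative
           - curvature \<alpha> s *\<^sub>R tangent \<alpha> s + torsion \<alpha> s *\<^sub>R binormal \<alpha> s) (at s)"
proof -
  obtain D where N': "(normal \<alpha> has_vector_derivative D) (at s)"
    using normal_differentiable[OF s] vector_derivative_works by blast
  have NN: "normal \<alpha> t \<bullet> normal \<alpha> t = 1" if "t \<in> I" for t
    using norm_normal[OF that] by (simp add: norm_eq_1)
  have NT: "normal \<alpha> t \<bullet> tangent \<alpha> t = 0" if "t \<in> I" for t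
    using tangent_inner_normal[OF that] by (simp add: inner_commute)
  have NB: "normal \<alpha> t \<bullet> binormal \<alpha> t = 0" if "t \<in> I" for t
    using binormal_orthonormal(3)[OF that] by (simp add: inner_commute)
  have "D \<bullet> normal \<alpha> s = 0"
    using constant_imp_derivative_eq_zero[OF I s has_vector_derivative_inner[OF N' N'] NN]
    by (simp add: inner_commute)
  moreover have "D \<bullet> tangent \<alpha> s = - curvature \<alpha> s"
    using constant_imp_derivative_eq_zero[OF I s
        has_vector_derivative_inner[OF N' has_vector_derivative_tangent[OF s]] NT] NN[OF s]
    by simp
  moreover have "D \<bullet> binormal \<alpha> s = torsion \<alpha> s"
    using constant_imp_derivative_eq_zero[OF I s
        has_vector_derivative_inner[OF N' has_vector_derivative_binormal[OF s]] NB] NN[OF s]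
    by simp
  ultimately have "D = - curvature \<alpha> s *\<^sub>R tangent \<alpha> s + torsion \<alpha> s *\<^sub>R binormal \<alpha> s"
    by (subst frenet_frame_expansion[OF s, of D]) simp
  then show ?thesis
    using N' by simp
qed

end

section \<open>Helices and the angle of the binormal with a fixed direction\<close>

text \<open>
  Differentiating \<open>\<gamma>' \<bullet> B = 0\<close>, where \<open>B\<close> is both the binormal of \<open>\<alpha>\<close> and the principal normal of
  \<open>\<gamma>\<close>, gives \<open>\<tau> (\<gamma>' \<bullet> N) = \<kappa>\<^sub>\<gamma>\<close>, and the curvature \<open>\<kappa>\<^sub>\<gamma>\<close> of \<open>\<gamma>\<close> has no zero.
\<close>

lemma torsion_nonzero_if_binormal_is_normal:
  assumes I: "open_interval I" and \<alpha>: "frenet_curve I \<alpha>" and \<gamma>: "frenet_curve I \<gamma>"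
    and eq: "\<And>t. t \<in> I \<Longrightarrow> normal \<gamma> t = binormal \<alpha> t" and s: "s \<in> I"
  shows "torsion \<alpha> s \<noteq> 0"
proof
  assume "torsion \<alpha> s = 0"
  then have B': "(binormal \<alpha> has_vector_derivative 0) (at s)"
    using has_vector_derivative_binormal[OF I \<alpha> s] by simp
  have "tangent \<gamma> t \<bullet> binormal \<alpha> t = 0" if "t \<in> I" for t
    using tangent_inner_normal[OF I \<gamma> that] eq[OF that] by simp
  from constant_imp_derivative_eq_zero[OF I s
      has_vector_derivative_inner[OF has_vector_derivative_tangent[OF I \<gamma> s] B'] this]
  have "curvature \<gamma> s = 0"
    using eq[OF s] binormal_orthonormal(1)[OF I \<alpha> s] by simp
  then show False
    using curvature_pos[OF I \<gamma> s] by simp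
qed

text \<open>
  By the Cauchy-Schwarz inequality the argument of \<open>arccos\<close> lies in \<open>[-1, 1]\<close>, where \<open>arccos\<close> is
  injective; so constancy of the angle and of the inner product are the same.
\<close>

lemma constant_angle_iff_constant_inner:
  fixes v :: "real \<Rightarrow> real^3"
  assumes v: "\<And>s. s \<in> I \<Longrightarrow> norm (v s) = 1" and d: "d \<noteq> 0"
  shows "(\<exists>\<theta>. \<forall>s\<in>I. vector_angle (v s) d = \<theta>) \<longleftrightarrow> (\<exists>k. \<forall>s\<in>I. v s \<bullet> d = k)"
proof
  assume "\<exists>\<theta>. \<forall>s\<in>I. vector_angle (v s) d = \<theta>"
  then obtain \<theta> where \<theta>: "\<And>s. s \<in> I \<Longrightarrow> vector_angle (v s) d = \<theta>"
    by blast
  have "v s \<bullet> d = cos \<theta> * norm d" if s: "s \<in> I" for s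
  proof -
    have "\<bar>v s \<bullet> d / norm d\<bar> \<le> 1"
      using Cauchy_Schwarz_ineq2[of "v s" d] v[OF s] d by (simp add: divide_le_eq)
    then have "cos \<theta> = v s \<bullet> d / norm d"
      using cos_arccos_abs \<theta>[OF s, symmetric] v[OF s] by (simp add: vector_angle_def del: abs_divide)
    then show ?thesis
      using d by simp
  qed
  then show "\<exists>k. \<forall>s\<in>I. v s \<bullet> d = k"
    by blast
next
  assume "\<exists>k. \<forall>s\<in>I. v s \<bullet> d = k"
  then show "\<exists>\<theta>. \<forall>s\<in>I. vector_angle (v s) d = \<theta>"
    using v by (auto simp: vector_angle_def)
qed

lemma helix_imp_binormal_angle:
  assumes I: "open_interval I" and \<alpha>: "frenet_curve I \<alpha>" and helix: "helix I \<alpha>"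
  obtains d k where "d \<noteq> 0" "\<And>s. s \<in> I \<Longrightarrow> binormal \<alpha> s \<bullet> d = k"
proof -
  obtain c where c: "\<And>s. s \<in> I \<Longrightarrow> torsion \<alpha> s / curvature \<alpha> s = c"
    using helix by (auto simp: helix_def)
  define f where "f s = c *\<^sub>R tangent \<alpha> s + binormal \<alpha> s" for s
  have "(f has_vector_derivative 0) (at s)" if s: "s \<in> I" for s
  proof -
    have "torsion \<alpha> s = c * curvature \<alpha> s"
      using c[OF s] curvature_pos[OF I \<alpha> s] by (auto simp: field_simps)
    then show ?thesis
      unfolding f_def
      using has_vector_derivative_add[OF
          bounded_linear.has_vector_derivative[OF bounded_linear_scaleR_right
            has_vector_derivative_tangent[OF I \<alpha> s], of c]
          has_vector_derivative_binormal[OF I \<alpha> s]]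
      by simp
  qed
  then obtain d where d: "\<And>s. s \<in> I \<Longrightarrow> f s = d"
    using zero_derivative_imp_constant[OF I] by metis
  have Bd: "binormal \<alpha> s \<bullet> d = 1" if s: "s \<in> I" for s
    using binormal_orthonormal[OF I \<alpha> s] d[OF s, symmetric] by (simp add: f_def inner_add_right)
  moreover have "d \<noteq> 0"
    using Bd I by (fastforce simp: open_interval_def)
  ultimately show ?thesis
    using that by blast
qed

lemma binormal_angle_imp_helix:
  assumes I: "open_interval I" and \<alpha>: "frenet_curve I \<alpha>"
    and \<tau>: "\<And>s. s \<in> I \<Longrightarrow> torsion \<alpha> s \<noteq> 0"
    and d: "d \<noteq> 0" and Bd: "\<And>s. s \<in> I \<Longrightarrow> binormal \<alpha> s \<bullet> d = k"
  shows "helix I \<alpha>"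
proof -
  note d' = has_vector_derivative_const[of d]
  have Nd: "normal \<alpha> s \<bullet> d = 0" if s: "s \<in> I" for s
    using constant_imp_derivative_eq_zero[OF I s
        has_vector_derivative_inner[OF has_vector_derivative_binormal[OF I \<alpha> s] d'] Bd] \<tau>[OF s]
    by simp
  have "((\<lambda>t. tangent \<alpha> t \<bullet> d) has_vector_derivative 0) (at s)" if s: "s \<in> I" for s
    using has_vector_derivative_inner[OF has_vector_derivative_tangent[OF I \<alpha> s] d'] Nd[OF s]
    by simp
  then obtain l where Td: "\<And>s. s \<in> I \<Longrightarrow> tangent \<alpha> s \<bullet> d = l"
    using zero_derivative_imp_constant[OF I, where f = "\<lambda>t. tangent \<alpha> t \<bullet> d"] by metis
  have rel: "torsion \<alpha> s * k = curvature \<alpha> s * l" if s: "s \<in> I" for s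
    using constant_imp_derivative_eq_zero[OF I s
        has_vector_derivative_inner[OF has_vector_derivative_normal[OF I \<alpha> s] d'] Nd]
      Bd[OF s] Td[OF s]
    by (simp add: inner_add_left inner_diff_left)
  \<comment> \<open>If \<open>k = 0\<close>, then also \<open>l = 0\<close>, and \<open>d\<close> would be orthogonal to the whole frame.\<close>
  obtain s0 where s0: "s0 \<in> I"
    using I by (auto simp: open_interval_def)
  have "k \<noteq> 0"
  proof
    assume "k = 0"
    then have "l = 0"
      using rel[OF s0] curvature_pos[OF I \<alpha> s0] by simp
    with \<open>k = 0\<close> have "d = 0"
      using Td[OF s0] Nd[OF s0] Bd[OF s0]
      by (subst frenet_frame_expansion[OF I \<alpha> s0, of d]) (simp add: inner_commute)
    with d show False ..
  qed
  then have "torsion \<alpha> s / curvature \<alpha> s = l / k" if "s \<in> I" for s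
    using rel[OF that] curvature_pos[OF I \<alpha> that] by (simp add: field_simps)
  then show ?thesis
    using \<alpha> by (auto simp: helix_def)
qed

text \<open>
  Whether \<open>\<gamma>\<close> is a slant helix depends on \<open>\<alpha>\<close> alone, because the principal normal of \<open>\<gamma>\<close> is the
  binormal of \<open>\<alpha>\<close>. Hence one Mannheim-direction curve of \<open>\<alpha>\<close> is a slant helix if and only if all are.
\<close>

lemma slant_helix_iff_helix_donor:
  assumes I: "open_interval I" and \<alpha>: "frenet_curve I \<alpha>"
    and \<gamma>: "mannheim_direction_curve I \<alpha> \<gamma>"
  shows "slant_helix I \<gamma> \<longleftrightarrow> helix I \<alpha>"
proof -
  have F: "frenet_curve I \<gamma>" and N: "\<And>s. s \<in> I \<Longrightarrow> normal \<gamma> s = binormal \<alpha> s"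
    using \<gamma> by (auto simp: mannheim_direction_curve_def mannheim_curve_def)
  have "slant_helix I \<gamma> \<longleftrightarrow>
      (\<exists>d. d \<noteq> 0 \<and> (\<exists>\<theta>. \<forall>s\<in>I. vector_angle (normal \<gamma> s) d = \<theta>))"
    using F by (auto simp: slant_helix_def)
  also have "\<dots> \<longleftrightarrow> (\<exists>d. d \<noteq> 0 \<and> (\<exists>k. \<forall>s\<in>I. normal \<gamma> s \<bullet> d = k))"
    by (intro ex_cong1 conj_cong refl constant_angle_iff_constant_inner norm_normal[OF I F])
  also have "\<dots> \<longleftrightarrow> (\<exists>d. d \<noteq> 0 \<and> (\<exists>k. \<forall>s\<in>I. binormal \<alpha> s \<bullet> d = k))"
    using N by simp
  also have "\<dots> \<longleftrightarrow> helix I \<alpha>"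
    using helix_imp_binormal_angle[OF I \<alpha>] binormal_angle_imp_helix[OF I \<alpha>]
      torsion_nonzero_if_binormal_is_normal[OF I \<alpha> F N]
    by metis
  finally show ?thesis .
qed

theorem theorem4p7:
  fixes I :: "real set" and \<alpha> \<beta> :: "real \<Rightarrow> real^3"
  assumes "open_interval I"
    and "frenet_curve I \<alpha>"
    and "mannheim_direction_curve I \<alpha> \<beta>"
  shows "(helix I \<alpha> \<longleftrightarrow> (\<exists>\<gamma>. slant_helix I \<gamma> \<and> mannheim_donor_curve I \<gamma> \<alpha>)) \<and>
         (helix I \<alpha> \<longleftrightarrow> (\<forall>\<gamma>. mannheim_direction_curve I \<alpha> \<gamma> \<longrightarrow> slant_helix I \<gamma>))"
  using slant_helix_iff_helix_donor[OF assms(1,2)] assms(3)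
  unfolding mannheim_donor_curve_def by blast

end
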